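(* The dcpo $P=2^{<\omega}\mathbin{\dot\cup}[0,1]$ (with the binary-expansion order defined in the context) contains no sub-dcpo isomorphic to $[0,1]$ with its usual order.
   Context: Let $T=2^{<\omega}$ be the set of finite binary words with the prefix order $\preccurlyeq$, and $X=2^\omega$ the set of infinite binary sequences. For $s\in T$, $[s]=\{\alpha\in X: s \text{ is a prefix of }\alpha\}$. Let $\pi:X\to[0,1]$, $\pi(\alpha)=\sum_{n=0}^\infty \alpha(n)/2^{n+1}$. The poset $P=T\mathbin{\dot\cup}[0,1]$ (disjoint union) is ordered by: for $s,t\in T$, $s\le t$ iff $s\preccurlyeq t$; for $s\in T$, $r\in[0,1]$, $s\le r$ iff $r\in\pi([s])$; for $r,q\in[0,1]$, $r\le q$ iff $r=q$; no other comparabilities. It is a dcpo (every nonempty directed subset has a supremum). A sub-dcpo of $P$ is a subset closed under suprema (taken in $P$) of its nonempty directed subsets, with the inherited order. (The usual order on $[0,1]$ in the claim is not the discrete order that the copy of $[0,1]$ inside $P$ carries.) *)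

theory Defs
  imports "HOL-Analysis.Analysis" "HOL-Library.Sublist" "HOL-Library.Lub_Glb"
begin

definition directed :: "'a::order set \<Rightarrow> bool" where
  "directed D \<longleftrightarrow> D \<noteq> {} \<and> (\<forall>x\<in>D. \<forall>y\<in>D. \<exists>z\<in>D. x \<le> z \<and> y \<le> z)"

definition is_dcpo :: "'a::order itself \<Rightarrow> bool" where
  "is_dcpo _ \<longleftrightarrow> (\<forall>D::'a set. directed D \<longrightarrow> (\<exists>x. isLub UNIV D x))"

text \<open>
  The supremum is the one of the ambient order, not of the induced order on \<open>S\<close>.
\<close>

definition sub_dcpo :: "'a::order set \<Rightarrow> bool" where
  "sub_dcpo S \<longleftrightarrow> (\<forall>D x. D \<subseteq> S \<and> directed D \<and> isLub UNIV D x \<longrightarrow> x \<in> S)"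

definition order_isomorphic :: "'a::order set \<Rightarrow> 'b::order set \<Rightarrow> bool" where
  "order_isomorphic A B \<longleftrightarrow>
     (\<exists>f. bij_betw f A B \<and> (\<forall>x\<in>A. \<forall>y\<in>A. x \<le> y \<longleftrightarrow> f x \<le> f y))"

definition cylinder :: "bool list \<Rightarrow> (nat \<Rightarrow> bool) set" where
  "cylinder s = {\<alpha>. \<forall>i<length s. \<alpha> i = s ! i}"

definition binary_value :: "(nat \<Rightarrow> bool) \<Rightarrow> real" where
  "binary_value \<alpha> = (\<Sum>n. of_bool (\<alpha> n) / 2 ^ (n + 1))"

typedef unit_interval = "{0..1::real}"
  by (rule exI[of _ 0]) simp

text \<open>
  The disjoint union of the finite binary words and the unit interval. The type
  \<open>unit_interval\<close> is deliberately given no order of its own: its copy in \<open>P\<close> is discrete.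
\<close>

datatype P = Word "bool list" | Point unit_interval

instantiation P :: order
begin

fun less_eq_P :: "P \<Rightarrow> P \<Rightarrow> bool" where
  "Word s \<le> Word t \<longleftrightarrow> prefix s t"
| "Word s \<le> Point r \<longleftrightarrow> Rep_unit_interval r \<in> binary_value ` cylinder s"
| "Point r \<le> Point q \<longleftrightarrow> r = q"
| "Point r \<le> Word s \<longleftrightarrow> False"

definition less_P :: "P \<Rightarrow> P \<Rightarrow> bool" where
  "x < y \<longleftrightarrow> x \<le> y \<and> \<not> y \<le> (x::P)"

lemma cylinder_antimono: "prefix s t \<Longrightarrow> cylinder t \<subseteq> cylinder s"
  by (auto simp: cylinder_def prefix_def nth_append)

instance
proof
  fix x y z :: P
  show "x < y \<longleftrightarrow> x \<le> y \<and> \<not> y \<le> x" by (rule less_P_def)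
  show "x \<le> x" by (cases x) auto
  show "x \<le> z" if "x \<le> y" "y \<le> z"
    using that
    by (cases x; cases y; cases z) (auto dest: cylinder_antimono prefix_order.trans)
  show "x = y" if "x \<le> y" "y \<le> x"
    using that by (cases x; cases y) auto
qed

end

lemma summable_binary: "summable (\<lambda>n. of_bool (\<alpha> n) / 2 ^ (n + 1) :: real)"
  by (rule summable_comparison_test'[of "\<lambda>n. (1/2)^n" 0])
     (use summable_geometric[of "1/2::real"] in \<open>auto simp: field_simps\<close>)

lemma binary_value_in_unit: "binary_value \<alpha> \<in> {0..1}"
proof -
  have s: "(\<lambda>n. 1 / 2 ^ (n + 1) :: real) sums 1"
    using power_half_series by (simp add: power_divide)
  have "binary_value \<alpha> \<le> (\<Sum>n. 1 / 2 ^ (n + 1))"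
    unfolding binary_value_def
    by (intro suminf_le summable_binary sums_summable[OF s]) (simp add: divide_right_mono)
  moreover have "0 \<le> binary_value \<alpha>"
    unfolding binary_value_def by (intro suminf_nonneg summable_binary) simp
  ultimately show ?thesis using sums_unique[OF s] by simp
qed

lemma binary_value_split:
  "binary_value \<alpha> = (\<Sum>n<k. of_bool (\<alpha> n) / 2 ^ (n + 1)) + binary_value (\<lambda>n. \<alpha> (n + k)) / 2 ^ k"
proof -
  have "binary_value \<alpha> = (\<Sum>n. of_bool (\<alpha> (n + k)) / 2 ^ (n + k + 1)) +
      (\<Sum>n<k. of_bool (\<alpha> n) / 2 ^ (n + 1))"
    unfolding binary_value_def by (rule suminf_split_initial_segment[OF summable_binary])
  also have "(\<Sum>n. of_bool (\<alpha> (n + k)) / 2 ^ (n + k + 1) :: real) =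
      (\<Sum>n. of_bool (\<alpha> (n + k)) / 2 ^ (n + 1) / 2 ^ k)"
    by (simp add: power_add field_simps)
  also have "\<dots> = binary_value (\<lambda>n. \<alpha> (n + k)) / 2 ^ k"
    unfolding binary_value_def by (rule suminf_divide[OF summable_binary])
  finally show ?thesis by simp
qed

lemma binary_value_close:
  assumes "\<alpha> \<in> cylinder s" "\<beta> \<in> cylinder s"
  shows "\<bar>binary_value \<alpha> - binary_value \<beta>\<bar> \<le> 1 / 2 ^ length s"
proof -
  let ?k = "length s"
  let ?a = "binary_value (\<lambda>n. \<alpha> (n + ?k))" and ?b = "binary_value (\<lambda>n. \<beta> (n + ?k))"
  have "(\<Sum>n<?k. of_bool (\<alpha> n) / 2 ^ (n + 1) :: real) = (\<Sum>n<?k. of_bool (\<beta> n) / 2 ^ (n + 1))"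
    using assms by (intro sum.cong) (auto simp: cylinder_def)
  then have "binary_value \<alpha> - binary_value \<beta> = (?a - ?b) / 2 ^ ?k"
    using binary_value_split[of \<alpha> ?k] binary_value_split[of \<beta> ?k]
    by (simp add: diff_divide_distrib)
  moreover have "\<bar>?a - ?b\<bar> \<le> 1"
    using binary_value_in_unit[of "\<lambda>n. \<alpha> (n + ?k)"] binary_value_in_unit[of "\<lambda>n. \<beta> (n + ?k)"]
    by auto
  ultimately show ?thesis by (simp add: abs_divide divide_right_mono)
qed

lemma isLub_UNIV_iff:
  "isLub UNIV D (x::'a::order) \<longleftrightarrow> (\<forall>d\<in>D. d \<le> x) \<and> (\<forall>y. (\<forall>d\<in>D. d \<le> y) \<longrightarrow> x \<le> y)"
  by (auto simp: isLub_def leastP_def isUb_def setle_def setge_def)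

theorem P_is_dcpo: "is_dcpo TYPE(P)"
  unfolding is_dcpo_def
proof (intro allI impI)
  fix D :: "P set"
  assume D: "directed D"
  then have ne: "D \<noteq> {}" by (simp add: directed_def)
  have max: "\<exists>x. isLub UNIV D x" if m: "m \<in> D" "\<And>z. z \<in> D \<Longrightarrow> m \<le> z \<Longrightarrow> z = m" for m
  proof -
    have "d \<le> m" if "d \<in> D" for d
      using D that m unfolding directed_def by metis
    then show ?thesis using m(1) by (auto simp: isLub_UNIV_iff)
  qed
  show "\<exists>x. isLub UNIV D x"
  proof (cases "\<exists>m\<in>D. \<forall>z\<in>D. m \<le> z \<longrightarrow> z = m")
    case True
    then show ?thesis using max by blast
  next
    case nomax: False
    have words: "\<exists>s. d = Word s" if "d \<in> D" for d
    proof (cases d)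
      case (Point r)
      have "z = Point r" if "Point r \<le> z" for z
        using that by (cases z) auto
      then show ?thesis using nomax \<open>d \<in> D\<close> Point by blast
    qed auto
    have long: "\<exists>s. Word s \<in> D \<and> n \<le> length s" for n
    proof (induction n)
      case 0
      then show ?case using ne words by blast
    next
      case (Suc n)
      then obtain s where s: "Word s \<in> D" "n \<le> length s" by blast
      then obtain z where z: "z \<in> D" "Word s \<le> z" "z \<noteq> Word s" using nomax by blast
      then obtain t where t: "z = Word t" using words by blast
      then have "prefix s t" "s \<noteq> t" using z by auto
      then have "length s < length t"
        by (simp add: prefix_length_less prefix_order.less_le)
      then show ?case using s z t by (metis Suc_le_eq le_less_trans)
    qed
    have agree: "s ! i = t ! i" if "Word s \<in> D" "Word t \<in> D" "i < length s" "i < length t" for s t i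
    proof -
      have "\<exists>z\<in>D. Word s \<le> z \<and> Word t \<le> z"
        using D that(1,2) unfolding directed_def by simp
      then obtain z where z: "z \<in> D" "Word s \<le> z" "Word t \<le> z" by blast
      from words[OF z(1)] obtain u where u: "z = Word u" by blast
      have "prefix s u" "prefix t u" using z(2,3) by (simp_all add: u)
      then show ?thesis using that(3,4) by (metis nth_append prefixE)
    qed
    define \<alpha> where "\<alpha> i = (SOME s. Word s \<in> D \<and> Suc i \<le> length s) ! i" for i
    have \<alpha>: "\<alpha> \<in> cylinder s" if s: "Word s \<in> D" for s
    proof -
      have "\<alpha> i = s ! i" if "i < length s" for i
      proof -
        let ?t = "SOME t. Word t \<in> D \<and> Suc i \<le> length t"
        have "Word ?t \<in> D \<and> Suc i \<le> length ?t" by (rule someI_ex[OF long])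
        then have "?t ! i = s ! i" using that s by (intro agree) auto
        then show ?thesis by (simp add: \<alpha>_def)
      qed
      then show ?thesis by (simp add: cylinder_def)
    qed
    define r where "r = Abs_unit_interval (binary_value \<alpha>)"
    have r: "Rep_unit_interval r = binary_value \<alpha>"
      unfolding r_def using binary_value_in_unit by (rule Abs_unit_interval_inverse)
    have ub: "d \<le> Point r" if d: "d \<in> D" for d
    proof -
      obtain s where "d = Word s" using words[OF d] by blast
      then show ?thesis using r \<alpha> d by auto
    qed
    have least: "Point r \<le> y" if y: "\<forall>d\<in>D. d \<le> y" for y
    proof (cases y)
      case (Word t)
      obtain s where "Word s \<in> D" "Suc (length t) \<le> length s" using long by blast
      moreover have "prefix s t" using y Word \<open>Word s \<in> D\<close> by auto
      ultimately show ?thesis using prefix_length_le[of s t] by simp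
    next
      case (Point q)
      have "\<bar>Rep_unit_interval q - binary_value \<alpha>\<bar> \<le> (1/2) ^ n" for n
      proof -
        obtain s where s: "Word s \<in> D" "n \<le> length s" using long by blast
        then obtain \<beta> where \<beta>: "\<beta> \<in> cylinder s" "Rep_unit_interval q = binary_value \<beta>"
          using y Point by fastforce
        have "\<bar>Rep_unit_interval q - binary_value \<alpha>\<bar> \<le> (1/2) ^ length s"
          using binary_value_close[OF \<beta>(1) \<alpha>[OF s(1)]] \<beta>(2) by (simp add: power_divide)
        also have "\<dots> \<le> (1/2) ^ n"
          using s(2) by (intro power_decreasing) auto
        finally show ?thesis .
      qed
      then have "\<bar>Rep_unit_interval q - binary_value \<alpha>\<bar> \<le> 0"
        by (intro LIMSEQ_le_const[OF LIMSEQ_power_zero[of "1/2::real"]]) auto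
      then have "q = r" using r by (simp add: Rep_unit_interval_inject[symmetric])
      then show ?thesis using Point by simp
    qed
    show ?thesis using ub least by (auto simp: isLub_UNIV_iff)
  qed
qed

end

(* An element of P lying strictly below another one is a word, and only finitely many elements lie
   below a word. In the unit interval, however, 1/2 is not maximal and has infinitely many elements
   below it. *)
theory Submission
  imports Defs
begin

text \<open>No point lies below a word, so only the finitely many prefixes of \<open>t\<close>
  remain.\<close>

lemma finite_atMost_Word: "finite {..Word t}"
proof (rule finite_subset)
  show "{..Word t} \<subseteq> Word ` set (prefixes t)"
  proof
    fix x assume "x \<in> {..Word t}"
    then show "x \<in> Word ` set (prefixes t)" by (cases x) auto
  qed
qed simp

text \<open>Points are maximal in \<open>P\<close>, so \<open>a\<close> must be a word.\<close>

lemma finite_atMost_if_less: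
  fixes a b :: P
  assumes "a < b"
  shows "finite {..a}"
proof (cases a)
  case (Word t)
  then show ?thesis by (simp add: finite_atMost_Word)
next
  case (Point r)
  then have False using assms by (cases b) (auto simp: less_P_def)
  then show ?thesis ..
qed

theorem theorem3p17:
  shows "\<not> (\<exists>S :: P set. sub_dcpo S \<and> order_isomorphic S {0..1::real})"
proof
  assume "\<exists>S :: P set. sub_dcpo S \<and> order_isomorphic S {0..1::real}"
  then obtain S :: "P set" and f where bij: "bij_betw f S {0..1::real}"
    and iso: "\<forall>x\<in>S. \<forall>y\<in>S. x \<le> y \<longleftrightarrow> f x \<le> f y"
    unfolding order_isomorphic_def by auto
  have surj: "\<exists>x\<in>S. f x = q" if "q \<in> {0..1}" for q
    using that bij unfolding bij_betw_def by (metis image_iff)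
  \<comment> \<open>Any value strictly between 0 and 1 would serve in place of 1/2.\<close>
  obtain a where a: "a \<in> S" "f a = 1/2" using surj[of "1/2"] by auto
  obtain b where b: "b \<in> S" "f b = 1" using surj[of 1] by auto
  have "a < b" using a b iso by (simp add: less_le_not_le)
  then have "finite {..a}" by (rule finite_atMost_if_less)
  \<comment> \<open>Since \<open>f\<close> reflects the order, preimages in \<open>S\<close> of
    values up to 1/2 lie below \<open>a\<close>, even in all of \<open>P\<close>.\<close>
  moreover have "{0..1/2} \<subseteq> f ` {..a}"
  proof
    fix q :: real assume q: "q \<in> {0..1/2}"
    then obtain x where "x \<in> S" "f x = q" using surj[of q] by auto
    then show "q \<in> f ` {..a}" using a q iso by auto
  qed
  ultimately have "finite {0..1/2::real}" by (blast intro: finite_surj)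
  then show False by (simp add: infinite_Icc)
qed

end
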